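(* Let $\hat{x} \in \mathcal{X}_f$ be an arbitrary state and let $\mathcal{A} = \mathcal{A}(\hat{x})$ be the corresponding active set. Assume that $G^{\mathcal{A}}$ has full row rank, and let $K^\star$, $b^\star$ and $\mathcal{P}^\star$ be the feedback gain, the offset and the polytope associated with $\mathcal{A}$ as defined in the context. Let $$\mathcal{C} = \mathrm{proj}_x(\mathcal{P}_{\mathcal{F}} \cap \mathcal{H}),$$ where $$\mathcal{P}_{\mathcal{F}} = \{ \epsilon \in \mathbb{R}^{n+mN} \mid \begin{pmatrix} -E & G \end{pmatrix} \epsilon \leq w \}, \qquad \mathcal{H} = \{ \epsilon \in \mathbb{R}^{n+mN} \mid \begin{pmatrix} -K^\star & L \end{pmatrix} \epsilon = b^\star \},$$ and $L = \begin{pmatrix} I_m & 0 & \cdots & 0 \end{pmatrix} \in \mathbb{R}^{m \times mN}$. Then: (i) for all $x \in \mathcal{C}$, the feedback law $K^\star x + b^\star$ yields a control input $u(0) = K^\star x + b^\star$ that satisfies the constraints, $u(0) \in \mathcal{U}$; (ii) for all $x \in \mathcal{C}$, the successor state $x^+ = Ax + Bu(0)$ with $u(0) = K^\star x + b^\star$ is feasible, i.e. $x^+ \in \mathcal{X}_f$; (iii) $\mathcal{C} \supseteq \mathcal{P}^\star$.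
   Context: **Optimal control problem.** Let $A \in \mathbb{R}^{n\times n}$, $B \in \mathbb{R}^{n \times m}$, let $N \geq 1$ be a horizon, and consider, for a given initial state $x(0)$, $$\min_{u(0),\ldots,u(N-1),\,x(1),\ldots,x(N)} \ \|x(N)\|_P^2 + \sum_{k=0}^{N-1} \left( \|x(k)\|_Q^2 + \|u(k)\|_R^2 \right)$$ subject to $x(k+1) = Ax(k) + Bu(k)$, $x(k) \in \mathcal{X}$, $u(k) \in \mathcal{U}$ for $k = 0,\ldots,N-1$, and $x(N) \in \mathcal{T}$. Here $x(k) \in \mathbb{R}^n$, $u(k) \in \mathbb{R}^m$ and $\|v\|_M^2 = v'Mv$; a prime denotes the transpose. **Standing assumptions.** $(A,B)$ is stabilizable, $(Q^{1/2},A)$ is detectable, and $Q \succ 0$, $R \succ 0$ are symmetric. The sets $\mathcal{X} \subset \mathbb{R}^n$, $\mathcal{U} \subset \mathbb{R}^m$ and $\mathcal{T} \subseteq \mathcal{X}$ are convex compact polytopes containing the origin as an interior point. $P \succ 0$ is the (stabilizing) solution of the discrete-time algebraic Riccati equation for $(A,B,Q,R)$. $\mathcal{T}$ is the largest set on which the linear quadratic regulator $u = K_{\mathrm{LQR}}x$, $K_{\mathrm{LQR}} = -(R+B'PB)^{-1}B'PA$, satisfies the constraints and stabilizes the system, i.e. the set of all $x$ such that $(A+BK_{\mathrm{LQR}})^k x \in \mathcal{X}$ and $K_{\mathrm{LQR}}(A+BK_{\mathrm{LQR}})^k x \in \mathcal{U}$ for all integers $k \geq 0$. **Quadratic program.**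 Let $\bar{U} = (u(0)',\ldots,u(N-1)')' \in \mathbb{R}^{mN}$. Substituting the dynamics into the cost function and the constraints turns the problem into $$\min_{\bar{U}} \ \tfrac12 \bar{U}'H\bar{U} + x(0)'F\bar{U} + \tfrac12 x(0)'Yx(0) \quad \text{s.t.} \quad G\bar{U} \leq w + Ex(0),$$ where $Y \in \mathbb{R}^{n\times n}$, $F \in \mathbb{R}^{n\times mN}$, $H \in \mathbb{R}^{mN\times mN}$ ($H \succ 0$), $G \in \mathbb{R}^{q\times mN}$, $w \in \mathbb{R}^q$, $E \in \mathbb{R}^{q\times n}$, and $q$ is the number of constraints. Thus $G\bar{U} \leq w + Ex(0)$ holds if and only if the state trajectory generated from $x(0)$ by $\bar{U}$ satisfies $x(k) \in \mathcal{X}$, $u(k) \in \mathcal{U}$ for $k=0,\ldots,N-1$ and $x(N) \in \mathcal{T}$. A state $x \in \mathbb{R}^n$ is *feasible* if there exists $\bar{U}$ with $G\bar{U} \leq w + Ex$; $\mathcal{X}_f$ is the set of all feasible states. For $x \in \mathcal{X}_f$ (taking $x(0)=x$) the quadratic program has a unique optimizer $\bar{U}^\star$. **Active and inactive sets.** Let $\mathcal{Q} = \{1,\ldots,q\}$. For $x \in \mathcal{X}_f$ with optimizer $\bar{U}^\star$, let $\mathcal{A}(x) = \{ i \in \mathcal{Q} \mid G^i\bar{U}^\star - w^i - E^i x = 0\}$ and $\mathcal{I}(x) = \mathcal{Q}\setminus\mathcal{A}(x)$. Superscripts such as $G^i$, $G^{\mathcal{A}}$, $w^{\mathcal{I}}$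 denote the submatrix or subvector of the rows with the given index or indices. **Optimal law and polytope of an active set.** For an active set $\mathcal{A} = \mathcal{A}(\hat{x})$ such that $G^{\mathcal{A}}$ has full row rank, and $\mathcal{I} = \mathcal{Q}\setminus\mathcal{A}$, let $S = E + GH^{-1}F' \in \mathbb{R}^{q \times n}$ and define $$\bar{K}^\star = H^{-1}(G^{\mathcal{A}})'(G^{\mathcal{A}}H^{-1}(G^{\mathcal{A}})')^{-1}S^{\mathcal{A}} - H^{-1}F', \qquad \bar{b}^\star = H^{-1}(G^{\mathcal{A}})'(G^{\mathcal{A}}H^{-1}(G^{\mathcal{A}})')^{-1}w^{\mathcal{A}},$$ $$T^\star = \begin{pmatrix} G^{\mathcal{I}}H^{-1}(G^{\mathcal{A}})'(G^{\mathcal{A}}H^{-1}(G^{\mathcal{A}})')^{-1}S^{\mathcal{A}} - S^{\mathcal{I}} \\ (G^{\mathcal{A}}H^{-1}(G^{\mathcal{A}})')^{-1}S^{\mathcal{A}} \end{pmatrix}, \qquad d^\star = -\begin{pmatrix} G^{\mathcal{I}}H^{-1}(G^{\mathcal{A}})'(G^{\mathcal{A}}H^{-1}(G^{\mathcal{A}})')^{-1}w^{\mathcal{A}} - w^{\mathcal{I}} \\ (G^{\mathcal{A}}H^{-1}(G^{\mathcal{A}})')^{-1}w^{\mathcal{A}} \end{pmatrix},$$ and $\mathcal{P}^\star = \{x \in \mathbb{R}^n \mid T^\star x \leq d^\star\}$. (If $\mathcal{A}$ is empty, the terms involving $\mathcal{A}$ are absent, so $\bar{K}^\star = -H^{-1}F'$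 and $\bar{b}^\star = 0$.) $K^\star \in \mathbb{R}^{m\times n}$ and $b^\star \in \mathbb{R}^m$ consist of the first $m$ rows of $\bar{K}^\star$ and $\bar{b}^\star$, respectively. **Augmented space.** Points of $\mathbb{R}^{n+mN}$ are written $\epsilon = (x', u(0)', u(1)', \ldots, u(N-1)')'$ with $x\in\mathbb{R}^n$ and $u(k) \in \mathbb{R}^m$, and $\mathrm{proj}_x$ denotes projection onto the first $n$ coordinates $x$. *)

theory Defs
  imports
    "Jordan_Normal_Form.Gauss_Jordan_Elimination"
    "Jordan_Normal_Form.Char_Poly"
    "Jordan_Normal_Form.DL_Rank"
    "Jordan_Normal_Form.DL_Submatrix"
begin

text \<open>Used only on invertible matrices. The unique matrix of size zero by zero is its own inverse.\<close>

definition minv :: "real mat \<Rightarrow> real mat" where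
  "minv M = the (mat_inverse M)"

definition hcat :: "real mat \<Rightarrow> real mat \<Rightarrow> real mat" where
  "hcat M1 M2 = four_block_mat M1 M2 (0\<^sub>m 0 (dim_col M1)) (0\<^sub>m 0 (dim_col M2))"

definition sub_rows :: "real mat \<Rightarrow> nat set \<Rightarrow> real mat" where
  "sub_rows M I = submatrix M I UNIV"

text \<open>The order of the entries is the one that the library's submatrix uses for rows.\<close>

definition sub_vec :: "real vec \<Rightarrow> nat set \<Rightarrow> real vec" where
  "sub_vec v I = vec (card {i. i < dim_vec v \<and> i \<in> I}) (\<lambda>i. v $ pick I i)"

definition full_row_rank :: "real mat \<Rightarrow> bool" where
  "full_row_rank M \<longleftrightarrow> vec_space.rank (dim_row M) M = dim_row M"

definition quad :: "real mat \<Rightarrow> real vec \<Rightarrow> real" where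
  "quad M v = v \<bullet> (M *\<^sub>v v)"

definition pos_def :: "nat \<Rightarrow> real mat \<Rightarrow> bool" where
  "pos_def n M \<longleftrightarrow> M \<in> carrier_mat n n \<and> M\<^sup>T = M \<and>
     (\<forall>v \<in> carrier_vec n. v \<noteq> 0\<^sub>v n \<longrightarrow> quad M v > 0)"

definition pos_semidef :: "nat \<Rightarrow> real mat \<Rightarrow> bool" where
  "pos_semidef n M \<longleftrightarrow> M \<in> carrier_mat n n \<and> M\<^sup>T = M \<and>
     (\<forall>v \<in> carrier_vec n. quad M v \<ge> 0)"

text \<open>The symmetric positive semidefinite square root; it exists and is unique for positive
  semidefinite arguments.\<close>

definition psd_sqrt :: "real mat \<Rightarrow> real mat" where
  "psd_sqrt M = (THE S. pos_semidef (dim_row M) S \<and> S * S = M)"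

text \<open>A polytope is a bounded intersection of finitely many closed half-spaces. In particular it
  is closed and convex, and hence compact.\<close>

definition polytope_in :: "nat \<Rightarrow> real vec set \<Rightarrow> bool" where
  "polytope_in n S \<longleftrightarrow>
     (\<exists>r C c. C \<in> carrier_mat r n \<and> c \<in> carrier_vec r \<and> S = {x \<in> carrier_vec n. C *\<^sub>v x \<le> c}) \<and>
     (\<exists>b. \<forall>x \<in> S. sqrt (x \<bullet> x) \<le> b)"

definition zero_interior :: "nat \<Rightarrow> real vec set \<Rightarrow> bool" where
  "zero_interior n S \<longleftrightarrow> (\<exists>r > 0. \<forall>x \<in> carrier_vec n. sqrt (x \<bullet> x) < r \<longrightarrow> x \<in> S)"

definition schur_stable :: "real mat \<Rightarrow> bool" where
  "schur_stable M \<longleftrightarrow> (\<forall>z. eigenvalue (map_mat complex_of_real M) z \<longrightarrow> cmod z < 1)"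

definition stabilizable :: "real mat \<Rightarrow> real mat \<Rightarrow> bool" where
  "stabilizable A B \<longleftrightarrow> (\<exists>K \<in> carrier_mat (dim_col B) (dim_row A). schur_stable (A + B * K))"

definition detectable :: "real mat \<Rightarrow> real mat \<Rightarrow> bool" where
  "detectable C A \<longleftrightarrow> (\<exists>J \<in> carrier_mat (dim_row A) (dim_row C). schur_stable (A + J * C))"

definition lqr_gain :: "real mat \<Rightarrow> real mat \<Rightarrow> real mat \<Rightarrow> real mat \<Rightarrow> real mat" where
  "lqr_gain A B R P = - (minv (R + B\<^sup>T * P * B) * (B\<^sup>T * P * A))"

definition stabilizing_dare_solution ::
  "real mat \<Rightarrow> real mat \<Rightarrow> real mat \<Rightarrow> real mat \<Rightarrow> real mat \<Rightarrow> bool" where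
  "stabilizing_dare_solution A B Q R P \<longleftrightarrow>
     P = A\<^sup>T * P * A - A\<^sup>T * P * B * minv (R + B\<^sup>T * P * B) * (B\<^sup>T * P * A) + Q \<and>
     schur_stable (A + B * lqr_gain A B R P)"

text \<open>Convergence to the origin is not part of this set: the closed loop matrix A + B * K is Schur
  stable whenever K is the gain of a stabilizing Riccati solution.\<close>

definition lqr_set ::
  "real mat \<Rightarrow> real mat \<Rightarrow> real mat \<Rightarrow> real vec set \<Rightarrow> real vec set \<Rightarrow> real vec set" where
  "lqr_set A B K X U = {x \<in> carrier_vec (dim_row A).
     \<forall>k. (A + B * K) ^\<^sub>m k *\<^sub>v x \<in> X \<and> K *\<^sub>v ((A + B * K) ^\<^sub>m k *\<^sub>v x) \<in> U}"

text \<open>An input sequence is one stacked vector; the input at time k (with m components) is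
  the block of its entries at the positions k * m, ..., k * m + m - 1.\<close>

definition input_at :: "nat \<Rightarrow> real vec \<Rightarrow> nat \<Rightarrow> real vec" where
  "input_at m Ub k = vec m (\<lambda>i. Ub $ (k * m + i))"

primrec state_at :: "real mat \<Rightarrow> real mat \<Rightarrow> real vec \<Rightarrow> real vec \<Rightarrow> nat \<Rightarrow> real vec" where
  "state_at A B x Ub 0 = x"
| "state_at A B x Ub (Suc k) = A *\<^sub>v state_at A B x Ub k + B *\<^sub>v input_at (dim_col B) Ub k"

definition ocp_cost ::
  "real mat \<Rightarrow> real mat \<Rightarrow> real mat \<Rightarrow> real mat \<Rightarrow> real mat \<Rightarrow> nat \<Rightarrow> real vec \<Rightarrow> real vec \<Rightarrow> real" where
  "ocp_cost A B Q R P N x Ub = quad P (state_at A B x Ub N) +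
     (\<Sum>k<N. quad Q (state_at A B x Ub k) + quad R (input_at (dim_col B) Ub k))"

definition ocp_admissible ::
  "real mat \<Rightarrow> real mat \<Rightarrow> real vec set \<Rightarrow> real vec set \<Rightarrow> real vec set \<Rightarrow> nat \<Rightarrow>
   real vec \<Rightarrow> real vec \<Rightarrow> bool" where
  "ocp_admissible A B X U T N x Ub \<longleftrightarrow>
     (\<forall>k<N. state_at A B x Ub k \<in> X \<and> input_at (dim_col B) Ub k \<in> U) \<and> state_at A B x Ub N \<in> T"

definition qp_cost :: "real mat \<Rightarrow> real mat \<Rightarrow> real mat \<Rightarrow> real vec \<Rightarrow> real vec \<Rightarrow> real" where
  "qp_cost H F Y x Ub = 1/2 * (Ub \<bullet> (H *\<^sub>v Ub)) + x \<bullet> (F *\<^sub>v Ub) + 1/2 * (x \<bullet> (Y *\<^sub>v x))"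

definition qp_feasible :: "real mat \<Rightarrow> real vec \<Rightarrow> real mat \<Rightarrow> real vec \<Rightarrow> real vec \<Rightarrow> bool" where
  "qp_feasible G w E x Ub \<longleftrightarrow> Ub \<in> carrier_vec (dim_col G) \<and> G *\<^sub>v Ub \<le> w + E *\<^sub>v x"

definition feasible_states :: "real mat \<Rightarrow> real vec \<Rightarrow> real mat \<Rightarrow> real vec set" where
  "feasible_states G w E = {x \<in> carrier_vec (dim_col E). \<exists>Ub. qp_feasible G w E x Ub}"

definition qp_optimizer :: "real mat \<Rightarrow> real mat \<Rightarrow> real mat \<Rightarrow> real mat \<Rightarrow> real vec \<Rightarrow> real mat \<Rightarrow>
    real vec \<Rightarrow> real vec" where
  "qp_optimizer H F Y G w E x = (THE Ub. qp_feasible G w E x Ub \<and>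
     (\<forall>V. qp_feasible G w E x V \<longrightarrow> qp_cost H F Y x Ub \<le> qp_cost H F Y x V))"

text \<open>Constraint indices start at 0, as the rows of matrices do.\<close>

definition active_set :: "real mat \<Rightarrow> real mat \<Rightarrow> real mat \<Rightarrow> real mat \<Rightarrow> real vec \<Rightarrow> real mat \<Rightarrow>
    real vec \<Rightarrow> nat set" where
  "active_set H F Y G w E x = {i. i < dim_row G \<and>
     row G i \<bullet> qp_optimizer H F Y G w E x - w $ i - row E i \<bullet> x = 0}"

text \<open>In the following definitions I is the set of active rows. All of them also cover the case
  of an empty I, where the products through a dimension of size zero are zero matrices and
  zero vectors.\<close>

definition S_mat :: "real mat \<Rightarrow> real mat \<Rightarrow> real mat \<Rightarrow> real mat \<Rightarrow> real mat" where
  "S_mat H F G E = E + G * minv H * F\<^sup>T"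

definition gram_inv :: "real mat \<Rightarrow> real mat \<Rightarrow> nat set \<Rightarrow> real mat" where
  "gram_inv H G I = minv (sub_rows G I * minv H * (sub_rows G I)\<^sup>T)"

definition K_bar :: "real mat \<Rightarrow> real mat \<Rightarrow> real mat \<Rightarrow> real mat \<Rightarrow> nat set \<Rightarrow> real mat" where
  "K_bar H F G E I =
     minv H * (sub_rows G I)\<^sup>T * gram_inv H G I * sub_rows (S_mat H F G E) I - minv H * F\<^sup>T"

definition b_bar :: "real mat \<Rightarrow> real mat \<Rightarrow> real vec \<Rightarrow> nat set \<Rightarrow> real vec" where
  "b_bar H G w I = (minv H * (sub_rows G I)\<^sup>T * gram_inv H G I) *\<^sub>v sub_vec w I"

definition K_star :: "nat \<Rightarrow> real mat \<Rightarrow> real mat \<Rightarrow> real mat \<Rightarrow> real mat \<Rightarrow> nat set \<Rightarrow> real mat" where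
  "K_star m H F G E I = sub_rows (K_bar H F G E I) {0..<m}"

definition b_star :: "nat \<Rightarrow> real mat \<Rightarrow> real mat \<Rightarrow> real vec \<Rightarrow> nat set \<Rightarrow> real vec" where
  "b_star m H G w I = vec_first (b_bar H G w I) m"

definition T_star :: "real mat \<Rightarrow> real mat \<Rightarrow> real mat \<Rightarrow> real mat \<Rightarrow> nat set \<Rightarrow> real mat" where
  "T_star H F G E I =
     (let I' = {0..<dim_row G} - I; SI = sub_rows (S_mat H F G E) I in
       (sub_rows G I' * minv H * (sub_rows G I)\<^sup>T * gram_inv H G I * SI
          - sub_rows (S_mat H F G E) I')
       @\<^sub>r (gram_inv H G I * SI))"

definition d_star :: "real mat \<Rightarrow> real mat \<Rightarrow> real vec \<Rightarrow> nat set \<Rightarrow> real vec" where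
  "d_star H G w I =
     (let I' = {0..<dim_row G} - I in
       - (((sub_rows G I' * minv H * (sub_rows G I)\<^sup>T * gram_inv H G I) *\<^sub>v sub_vec w I
             - sub_vec w I')
          @\<^sub>v (gram_inv H G I *\<^sub>v sub_vec w I)))"

definition P_star :: "real mat \<Rightarrow> real mat \<Rightarrow> real mat \<Rightarrow> real vec \<Rightarrow> real mat \<Rightarrow> nat set \<Rightarrow> real vec set" where
  "P_star H F G w E I =
     {x \<in> carrier_vec (dim_col E). T_star H F G E I *\<^sub>v x \<le> d_star H G w I}"

definition P_F :: "real mat \<Rightarrow> real vec \<Rightarrow> real mat \<Rightarrow> real vec set" where
  "P_F G w E = {e \<in> carrier_vec (dim_col E + dim_col G). hcat (- E) G *\<^sub>v e \<le> w}"

definition L_mat :: "nat \<Rightarrow> nat \<Rightarrow> real mat" where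
  "L_mat m N = hcat (1\<^sub>m m) (0\<^sub>m m (m * (N - 1)))"

definition H_plane :: "nat \<Rightarrow> nat \<Rightarrow> real mat \<Rightarrow> real vec \<Rightarrow> real vec set" where
  "H_plane m N K b = {e \<in> carrier_vec (dim_col K + m * N). hcat (- K) (L_mat m N) *\<^sub>v e = b}"

definition proj_x :: "nat \<Rightarrow> real vec set \<Rightarrow> real vec set" where
  "proj_x n S = (\<lambda>e. vec_first e n) ` S"

end

theory Submission
  imports Defs
begin

text \<open>
  A state \<open>x\<close> lies in \<open>C\<close> exactly when some input sequence satisfies all constraints from \<open>x\<close> and
  starts with \<open>K *\<^sub>v x + b\<close> (\<open>mem_proj_x_iff\<close>). So \<open>C\<close> collects the states at which the law of
  the active set gives the first element of an admissible sequence.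

  The first input of an admissible sequence lies in \<open>U\<close>, which is (i).

  For (ii), the usual recursive feasibility argument applies: drop the first input of the admissible
  sequence and append the LQR input at its terminal state (\<open>ocp_admissible_shift\<close>).
  The appended input is allowed and the new terminal state stays in \<open>T\<close> because \<open>T\<close> consists of
  the states from which the LQR closed loop satisfies the constraints forever, and this set is invariant under the closed loop
  (\<open>lqr_set_invariant\<close>).

  For (iii), the witness at \<open>x \<in> P_star\<close> is the value \<open>K_bar *\<^sub>v x + b_bar\<close> of the affine law. It solves the
  active constraints with equality, since the Gram matrix of the active rows is invertible
  (\<open>gram_det_nonzero\<close>, the place where full row rank enters), and the first block of the
  inequalities defining \<open>P_star\<close> says precisely that it satisfies the inactive ones
  (\<open>affine_law_feasible_on_P_star\<close>).
\<close>

section \<open>Invertibility of the active Gram matrix\<close>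

lemma minv_of_det_nonzero:
  assumes M: "M \<in> carrier_mat k k" and det: "det M \<noteq> 0"
  shows "minv M \<in> carrier_mat k k" "M * minv M = 1\<^sub>m k" "minv M * M = 1\<^sub>m k"
proof -
  obtain M' where "mat_inverse M = Some M'"
    using mat_inverse(1)[OF M, where b = "()"] det_non_zero_imp_unit[OF M det, where b = "()"]
    by (cases "mat_inverse M") auto
  then show "minv M \<in> carrier_mat k k" "M * minv M = 1\<^sub>m k" "minv M * M = 1\<^sub>m k"
    using mat_inverse(2)[OF M] by (auto simp: minv_def)
qed

lemma pos_def_det_nonzero:
  assumes "pos_def p H"
  shows "det H \<noteq> 0"
proof
  assume "det H = 0"
  then obtain v where v: "v \<in> carrier_vec p" "v \<noteq> 0\<^sub>v p" "H *\<^sub>v v = 0\<^sub>v p"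
    using assms det_0_iff_vec_prod_zero_field[of H p] by (auto simp: pos_def_def)
  then have "quad H v = 0"
    by (simp add: quad_def)
  with v assms show False
    by (auto simp: pos_def_def)
qed

text \<open>Full row rank makes the columns span the whole space, so \<open>v\<close> has the form \<open>M *\<^sub>v x\<close>; then
  \<open>v \<bullet> v\<close> equals \<open>(M\<^sup>T *\<^sub>v v) \<bullet> x\<close>, which is zero.\<close>

lemma full_row_rank_transpose_kernel:
  assumes M: "M \<in> carrier_mat k nc" and rank: "full_row_rank M"
    and v: "v \<in> carrier_vec k" and ker: "M\<^sup>T *\<^sub>v v = 0\<^sub>v nc"
  shows "v = 0\<^sub>v k"
proof -
  interpret vec_space "TYPE(real)" k .
  have cols: "set (cols M) \<subseteq> carrier_vec k"
    using M cols_dim by blast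
  obtain S where "maximal S (\<lambda>T. T \<subseteq> set (cols M) \<and> lin_indpt T)"
    using maximal_exists_superset[of "set (cols M)" "\<lambda>T. T \<subseteq> set (cols M) \<and> lin_indpt T" "{}"]
    by (auto simp: lin_dep_def)
  then have S: "S \<subseteq> set (cols M)" "lin_indpt S" "card S = k"
    using rank_card_indpt[OF M] rank M by (auto simp: maximal_def full_row_rank_def)
  have "basis S"
  proof (rule dim_li_is_basis)
    show "finite S" "S \<subseteq> carrier_vec k" "lin_indpt S" "dim \<le> card S" "fin_dim"
      using S cols finite_subset by (auto simp: dim_is_n)
  qed
  then have "v \<in> span S"
    using v by (auto simp: basis_def)
  then have "v \<in> col_space M"
    using span_is_monotone[OF S(1)] by (auto simp: col_space_def)
  then obtain x where x: "x \<in> carrier_vec nc" "M *\<^sub>v x = v"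
    using col_space_eq[OF M] M by auto
  have "v \<bullet> v = (M\<^sup>T *\<^sub>v v) \<bullet> x"
    using transpose_vec_mult_scalar[OF M x(1) v] x(2) by simp
  also have "\<dots> = 0"
    using ker x by simp
  finally show ?thesis
    using v by (intro eq_vecI) (auto simp: scalar_prod_def sum_nonneg_eq_0_iff)
qed

text \<open>For \<open>v\<close> in the kernel of the Gram matrix put \<open>z = H\<^sup>-\<^sup>1 M\<^sup>T v\<close>. Then \<open>z\<^sup>T H z = v\<^sup>T M z = 0\<close>, so
  \<open>z\<close> vanishes by definiteness of \<open>H\<close>, hence so do \<open>H z = M\<^sup>T v\<close> and, by full row rank, \<open>v\<close>.\<close>

lemma gram_det_nonzero:
  assumes H: "pos_def p H" and M: "M \<in> carrier_mat k p" and rank: "full_row_rank M"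
  shows "det (M * minv H * M\<^sup>T) \<noteq> 0"
proof
  have Hc: "H \<in> carrier_mat p p"
    using H by (simp add: pos_def_def)
  note inv = minv_of_det_nonzero[OF Hc pos_def_det_nonzero[OF H]]
  assume "det (M * minv H * M\<^sup>T) = 0"
  moreover have "M * minv H * M\<^sup>T \<in> carrier_mat k k"
    using M inv by simp
  ultimately obtain v where v: "v \<in> carrier_vec k" "v \<noteq> 0\<^sub>v k"
    and ker: "M * minv H * M\<^sup>T *\<^sub>v v = 0\<^sub>v k"
    using det_0_iff_vec_prod_zero_field by blast
  define y z where "y = M\<^sup>T *\<^sub>v v" and "z = minv H *\<^sub>v y"
  have y: "y \<in> carrier_vec p" and z: "z \<in> carrier_vec p"
    using M v inv by (auto simp: y_def z_def)
  have Mz: "M *\<^sub>v z = 0\<^sub>v k"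
    using ker M v inv y
    by (simp add: y_def z_def assoc_mult_mat_vec[of _ k p _ k] assoc_mult_mat_vec[of _ p p _ k])
  have Hz: "H *\<^sub>v z = y"
    using inv Hc y by (simp add: z_def flip: assoc_mult_mat_vec)
  have "quad H z = y \<bullet> z"
    using y z by (simp add: quad_def Hz comm_scalar_prod[of _ p])
  also have "\<dots> = v \<bullet> (M *\<^sub>v z)"
    using transpose_vec_mult_scalar[OF M z v(1)] by (simp add: y_def)
  finally have "quad H z = 0"
    using v by (simp add: Mz)
  then have "z = 0\<^sub>v p"
    using H z by (auto simp: pos_def_def)
  moreover have "H *\<^sub>v 0\<^sub>v p = 0\<^sub>v p"
    using Hc by (intro eq_vecI) auto
  ultimately have "M\<^sup>T *\<^sub>v v = 0\<^sub>v p"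
    using Hz by (simp add: y_def)
  with full_row_rank_transpose_kernel[OF M rank v(1)] v(2) show False
    by simp
qed

section \<open>Selecting rows\<close>

lemma dim_sub_rows [simp]:
  "dim_row (sub_rows M I) = card {i. i < dim_row M \<and> i \<in> I}" "dim_col (sub_rows M I) = dim_col M"
  by (simp_all add: sub_rows_def dim_submatrix)

lemma dim_sub_vec [simp]: "dim_vec (sub_vec v I) = card {i. i < dim_vec v \<and> i \<in> I}"
  by (simp add: sub_vec_def)

lemma row_sub_rows:
  assumes "i < card {i. i < dim_row M \<and> i \<in> I}"
  shows "row (sub_rows M I) i = row M (pick I i)"
  using assms pick_le[OF assms]
  by (intro eq_vecI) (simp_all add: sub_rows_def submatrix_index pick_UNIV dim_submatrix)

lemma sub_rows_mult_vec:
  "sub_rows M I *\<^sub>v v = sub_vec (M *\<^sub>v v) I"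
  by (intro eq_vecI) (auto simp: sub_vec_def row_sub_rows pick_le)

lemma sub_vec_add:
  assumes "dim_vec u = dim_vec v"
  shows "sub_vec (u + v) I = sub_vec u I + sub_vec v I"
  using assms by (intro eq_vecI) (auto simp: sub_vec_def pick_le)

text \<open>Every index below the dimension is picked by the index set that contains it, at the position
  given by the number of its smaller members. This lets the active and the inactive constraints be
  treated separately.\<close>

lemma le_iff_sub_vec_le:
  assumes "dim_vec u = dim_vec v" and I: "I \<subseteq> {0..<dim_vec v}"
  shows "u \<le> v \<longleftrightarrow> sub_vec u I \<le> sub_vec v I \<and>
    sub_vec u ({0..<dim_vec v} - I) \<le> sub_vec v ({0..<dim_vec v} - I)"
    (is "_ \<longleftrightarrow> _ \<and> sub_vec u ?J \<le> sub_vec v ?J")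
proof
  assume "u \<le> v"
  then show "sub_vec u I \<le> sub_vec v I \<and> sub_vec u ?J \<le> sub_vec v ?J"
    by (auto simp: less_eq_vec_def sub_vec_def pick_le)
next
  have le: "u $ i \<le> v $ i"
    if "sub_vec u L \<le> sub_vec v L" and i: "i \<in> L" "i < dim_vec v" for i L
  proof -
    have "{a \<in> L. a < i} \<subset> {a. a < dim_vec v \<and> a \<in> L}"
      using i by auto
    then have "card {a \<in> L. a < i} < card {a. a < dim_vec v \<and> a \<in> L}"
      by (intro psubset_card_mono) simp_all
    with that assms(1) have "u $ pick L (card {a \<in> L. a < i}) \<le> v $ pick L (card {a \<in> L. a < i})"
      by (auto simp: less_eq_vec_def sub_vec_def)
    with i show ?thesis
      by (simp add: pick_card_in_set)
  qed
  assume "sub_vec u I \<le> sub_vec v I \<and> sub_vec u ?J \<le> sub_vec v ?J"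
  then show "u \<le> v"
    using assms(1) le[of I] le[of ?J] by (auto simp: less_eq_vec_def)
qed

lemma sub_vec_initial:
  assumes "k \<le> dim_vec v"
  shows "sub_vec v {0..<k} = vec_first v k"
proof -
  have "{i. i < dim_vec v \<and> i \<in> {0..<k}} = {0..<k}"
    using assms by auto
  moreover have "pick {0..<k} i = i" if "i < k" for i
  proof -
    have "{a \<in> {0..<k}. a < i} = {0..<i}"
      using that by auto
    then show ?thesis
      using pick_card_in_set[of i "{0..<k}"] that by simp
  qed
  ultimately show ?thesis
    by (intro eq_vecI) (auto simp: sub_vec_def vec_first_def)
qed

section \<open>Rearranging componentwise inequalities\<close>

lemma vec_diff_le_uminus_diff_iff:
  fixes a b c d :: "real vec"
  assumes "a \<in> carrier_vec k" "b \<in> carrier_vec k" "c \<in> carrier_vec k" "d \<in> carrier_vec k"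
  shows "a - b \<le> - (c - d) \<longleftrightarrow> a + c \<le> b + d"
  using assms by (auto simp: less_eq_vec_def algebra_simps)

lemma vec_diff_le_add_iff:
  fixes a b c d :: "real vec"
  assumes "a \<in> carrier_vec k" "b \<in> carrier_vec k" "c \<in> carrier_vec k" "d \<in> carrier_vec k"
  shows "a - b \<le> c + d \<longleftrightarrow> a \<le> d + b + c"
  using assms by (auto simp: less_eq_vec_def algebra_simps)

lemma uminus_vec_add_le_iff:
  fixes a b c :: "real vec"
  assumes "a \<in> carrier_vec k" "b \<in> carrier_vec k" "c \<in> carrier_vec k"
  shows "- a + b \<le> c \<longleftrightarrow> b \<le> c + a"
  using assms by (auto simp: less_eq_vec_def algebra_simps)

lemma uminus_vec_add_eq_iff:
  fixes a b c :: "real vec"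
  assumes "a \<in> carrier_vec k" "b \<in> carrier_vec k" "c \<in> carrier_vec k"
  shows "- a + b = c \<longleftrightarrow> b = a + c"
  using assms by (auto simp: vec_eq_iff algebra_simps)

section \<open>Feasibility of the affine law on its polytope\<close>

text \<open>Write the law as \<open>M *\<^sub>v z - y\<close>, where \<open>M\<close> is a right inverse of the active rows \<open>GI\<close>,
  \<open>z\<close> is the active part of \<open>S *\<^sub>v x + w\<close>, and \<open>- y = - H\<^sup>-\<^sup>1 F\<^sup>T x\<close> is the unconstrained minimizer.
  By the definition of \<open>S\<close>, subtracting \<open>G *\<^sub>v y\<close> turns \<open>S *\<^sub>v x + w\<close> into \<open>E *\<^sub>v x + w\<close>, so it suffices
  that \<open>G *\<^sub>v (M *\<^sub>v z) \<le> S *\<^sub>v x + w\<close>. On the active rows both sides equal \<open>z\<close>; on the inactive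
  rows this is the first block of the inequalities that define the polytope.\<close>

lemma affine_law_feasible_on_P_star:
  assumes H: "pos_def p H" and F: "F \<in> carrier_mat n p" and G: "G \<in> carrier_mat q p"
    and w: "w \<in> carrier_vec q" and E: "E \<in> carrier_mat q n"
    and I: "I \<subseteq> {0..<q}" and rank: "full_row_rank (sub_rows G I)"
    and x: "x \<in> P_star H F G w E I"
  shows "G *\<^sub>v (K_bar H F G E I *\<^sub>v x + b_bar H G w I) \<le> w + E *\<^sub>v x"
proof -
  define J where "J = {0..<q} - I"
  define k l where "k = card {i. i < q \<and> i \<in> I}" and "l = card {i. i < q \<and> i \<in> J}"
  define GI GJ Hi W where "GI = sub_rows G I" and "GJ = sub_rows G J" and "Hi = minv H"
    and "W = gram_inv H G I"
  define M where "M = Hi * GI\<^sup>T * W"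
  define S where "S = S_mat H F G E"
  define y where "y = Hi *\<^sub>v (F\<^sup>T *\<^sub>v x)"
  define z where "z = sub_rows S I *\<^sub>v x + sub_vec w I"
  have Hc: "H \<in> carrier_mat p p"
    using H by (simp add: pos_def_def)
  have xc: "x \<in> carrier_vec n"
    using x E by (simp add: P_star_def)
  have GI: "GI \<in> carrier_mat k p" and GJ: "GJ \<in> carrier_mat l p"
    using G by (auto simp: GI_def GJ_def k_def l_def)
  have Hi: "Hi \<in> carrier_mat p p"
    unfolding Hi_def by (rule minv_of_det_nonzero(1)[OF Hc pos_def_det_nonzero[OF H]])
  have S: "S \<in> carrier_mat q n"
    using E G F Hi by (simp add: S_def S_mat_def Hi_def)
  have SI: "sub_rows S I \<in> carrier_mat k n" and SJ: "sub_rows S J \<in> carrier_mat l n"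
    using S by (auto simp: k_def l_def)
  have wI: "sub_vec w I \<in> carrier_vec k" and wJ: "sub_vec w J \<in> carrier_vec l"
    using w by (auto intro!: carrier_vecI simp: k_def l_def)
  have y: "y \<in> carrier_vec p"
    using Hi F xc by (auto simp: y_def)
  have z: "z \<in> carrier_vec k"
    using SI wI xc by (auto simp: z_def)
  have gram: "GI * Hi * GI\<^sup>T \<in> carrier_mat k k"
    using GI Hi by simp
  have det: "det (GI * Hi * GI\<^sup>T) \<noteq> 0"
    unfolding Hi_def using gram_det_nonzero[OF H GI] rank by (simp add: GI_def)
  have W: "W \<in> carrier_mat k k" "GI * Hi * GI\<^sup>T * W = 1\<^sub>m k"
    using minv_of_det_nonzero[OF gram det] by (auto simp: W_def gram_inv_def GI_def Hi_def)
  have M: "M \<in> carrier_mat p k"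
    using Hi GI W by (simp add: M_def)
  have GIt: "GI\<^sup>T \<in> carrier_mat p k"
    using GI by simp
  have HG: "Hi * GI\<^sup>T \<in> carrier_mat p k"
    using Hi GIt by simp
  have GIM: "GI * M = 1\<^sub>m k"
    unfolding M_def using W(2) assoc_mult_mat[OF GI Hi GIt] assoc_mult_mat[OF GI HG W(1)] by simp
  have GJM: "GJ * Hi * GI\<^sup>T * W = GJ * M"
    unfolding M_def using assoc_mult_mat[OF GJ Hi GIt] assoc_mult_mat[OF GJ HG W(1)] by simp
  have GJM_carrier: "GJ * M \<in> carrier_mat l k"
    using GJ M by simp
  have law: "K_bar H F G E I *\<^sub>v x + b_bar H G w I = M *\<^sub>v z - y"
  proof -
    have "K_bar H F G E I *\<^sub>v x = M *\<^sub>v (sub_rows S I *\<^sub>v x) - y"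
      using M SI Hi F xc
      by (simp add: K_bar_def y_def minus_mult_distrib_mat_vec[of _ p n]
          flip: M_def S_def Hi_def GI_def W_def)
    moreover have "b_bar H G w I = M *\<^sub>v sub_vec w I"
      by (simp add: b_bar_def M_def Hi_def GI_def W_def)
    moreover have "M *\<^sub>v z = M *\<^sub>v (sub_rows S I *\<^sub>v x) + M *\<^sub>v sub_vec w I"
      unfolding z_def using M SI wI xc by (intro mult_add_distrib_mat_vec[of _ p k]) auto
    ultimately show ?thesis
      using M SI wI xc y by (intro eq_vecI) auto
  qed
  have Sx: "S *\<^sub>v x = E *\<^sub>v x + G *\<^sub>v y"
    using E G Hi F xc
    by (simp add: S_def S_mat_def y_def add_mult_distrib_mat_vec[of _ q n]
        assoc_mult_mat_vec[of _ q p _ n] assoc_mult_mat_vec[of _ p p _ n]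
        assoc_mult_mat[of _ q p _ p _ n] flip: Hi_def)
  have active: "sub_vec (G *\<^sub>v (M *\<^sub>v z)) I = sub_vec (S *\<^sub>v x + w) I"
  proof -
    have "sub_vec (G *\<^sub>v (M *\<^sub>v z)) I = GI * M *\<^sub>v z"
      using GI M z by (simp add: GI_def sub_rows_mult_vec)
    also have "\<dots> = sub_vec (S *\<^sub>v x + w) I"
      using z S w by (simp add: GIM z_def sub_vec_add sub_rows_mult_vec)
    finally show ?thesis .
  qed
  have inactive: "sub_vec (G *\<^sub>v (M *\<^sub>v z)) J \<le> sub_vec (S *\<^sub>v x + w) J"
  proof -
    have J': "{0..<dim_row G} - I = J"
      using G by (simp add: J_def)
    have first: "GJ * M * sub_rows S I - sub_rows S J \<in> carrier_mat l n"
      and second: "W * sub_rows S I \<in> carrier_mat k n"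
      using SI SJ W by (auto intro: minus_carrier_mat)
    have d: "d_star H G w I = - (GJ * M *\<^sub>v sub_vec w I - sub_vec w J) @\<^sub>v - (W *\<^sub>v sub_vec w I)"
      using GJ M wI wJ W
      by (intro eq_vecI)
        (auto simp: d_star_def J' Let_def GJM simp flip: GJ_def Hi_def GI_def W_def)
    have "T_star H F G E I *\<^sub>v x \<le> d_star H G w I"
      using x by (simp add: P_star_def)
    then have "(GJ * M * sub_rows S I - sub_rows S J) *\<^sub>v x \<le> - (GJ * M *\<^sub>v sub_vec w I - sub_vec w J)"
      unfolding d T_star_def Let_def J'
      using append_rows_le[OF first second _ xc] GJ M wI wJ
      by (simp add: GJM flip: GJ_def Hi_def GI_def W_def S_def)
    then have "GJ * M *\<^sub>v (sub_rows S I *\<^sub>v x) - sub_rows S J *\<^sub>v x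
        \<le> - (GJ * M *\<^sub>v sub_vec w I - sub_vec w J)"
      using minus_mult_distrib_mat_vec[OF mult_carrier_mat[OF GJM_carrier SI] SJ xc]
        assoc_mult_mat_vec[OF GJM_carrier SI xc] by simp
    then have "GJ * M *\<^sub>v (sub_rows S I *\<^sub>v x) + GJ * M *\<^sub>v sub_vec w I
        \<le> sub_rows S J *\<^sub>v x + sub_vec w J"
      using GJM_carrier SI SJ wI wJ xc by (subst (asm) vec_diff_le_uminus_diff_iff[of _ l]) auto
    moreover have "GJ * M *\<^sub>v (sub_rows S I *\<^sub>v x) + GJ * M *\<^sub>v sub_vec w I = GJ *\<^sub>v (M *\<^sub>v z)"
      using GJ M SI wI xc z
      by (simp add: z_def mult_add_distrib_mat_vec[of _ l k] flip: assoc_mult_mat_vec)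
    ultimately show ?thesis
      using S w by (simp add: GJ_def sub_rows_mult_vec sub_vec_add)
  qed
  have "G *\<^sub>v (M *\<^sub>v z) \<le> S *\<^sub>v x + w"
    using active inactive le_iff_sub_vec_le[of "G *\<^sub>v (M *\<^sub>v z)" "S *\<^sub>v x + w" I] G S w I
    by (simp add: J_def)
  moreover have "G *\<^sub>v (M *\<^sub>v z - y) = G *\<^sub>v (M *\<^sub>v z) - G *\<^sub>v y"
    using G M z y by (intro mult_minus_distrib_mat_vec[of _ q p]) auto
  ultimately show ?thesis
    unfolding law Sx using G E M w xc y z
    by (auto simp: vec_diff_le_add_iff[of _ q])
qed

lemma first_input_of_affine_law:
  assumes "m \<le> dim_row (K_bar H F G E I)" and "dim_row (K_bar H F G E I) = dim_vec (b_bar H G w I)"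
  shows "vec_first (K_bar H F G E I *\<^sub>v x + b_bar H G w I) m
    = K_star m H F G E I *\<^sub>v x + b_star m H G w I"
  using assms
  by (intro eq_vecI)
    (auto simp: K_star_def b_star_def sub_rows_mult_vec sub_vec_initial vec_first_def)

section \<open>Membership in the projected set\<close>

lemma hcat_mult_append:
  assumes "M1 \<in> carrier_mat r c1" "M2 \<in> carrier_mat r c2" "u \<in> carrier_vec c1" "v \<in> carrier_vec c2"
  shows "hcat M1 M2 *\<^sub>v (u @\<^sub>v v) = M1 *\<^sub>v u + M2 *\<^sub>v v"
  using assms
  by (simp add: hcat_def four_block_mat_mult_vec[of _ r c1 _ c2 _ 0]) (intro eq_vecI; auto)

lemma L_mat_mult:
  assumes "N \<ge> 1" and "v \<in> carrier_vec (m * N)"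
  shows "L_mat m N *\<^sub>v v = vec_first v m"
proof -
  have "m * N = m + m * (N - 1)"
    using assms(1) by (cases N) auto
  then have "v = vec_first v m @\<^sub>v vec_last v (m * (N - 1))"
    using assms(2) by simp
  then have "L_mat m N *\<^sub>v v = hcat (1\<^sub>m m) (0\<^sub>m m (m * (N - 1))) *\<^sub>v (vec_first v m @\<^sub>v vec_last v (m * (N - 1)))"
    by (simp add: L_mat_def)
  also have "\<dots> = vec_first v m"
    by (subst hcat_mult_append[of _ m m _ "m * (N - 1)"])
      (auto intro!: eq_vecI)
  finally show ?thesis .
qed

lemma vec_first_append:
  assumes "u \<in> carrier_vec k"
  shows "vec_first (u @\<^sub>v v) k = u"
  using assms by (auto simp: vec_first_def)

lemma mem_proj_x_iff:
  assumes "N \<ge> 1" and "G \<in> carrier_mat q (m * N)" and "w \<in> carrier_vec q" and "E \<in> carrier_mat q n"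
    and "K \<in> carrier_mat m n" and "b \<in> carrier_vec m"
  shows "x \<in> proj_x n (P_F G w E \<inter> H_plane m N K b) \<longleftrightarrow> x \<in> carrier_vec n \<and>
    (\<exists>Ub \<in> carrier_vec (m * N). G *\<^sub>v Ub \<le> w + E *\<^sub>v x \<and> vec_first Ub m = K *\<^sub>v x + b)"
proof -
  have lift: "u @\<^sub>v v \<in> P_F G w E \<inter> H_plane m N K b \<longleftrightarrow>
      G *\<^sub>v v \<le> w + E *\<^sub>v u \<and> vec_first v m = K *\<^sub>v u + b"
    if u: "u \<in> carrier_vec n" and v: "v \<in> carrier_vec (m * N)" for u v
  proof -
    have "hcat (- E) G *\<^sub>v (u @\<^sub>v v) = - E *\<^sub>v u + G *\<^sub>v v"
      using assms u v by (intro hcat_mult_append[of _ q n _ "m * N"]) auto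
    then have "hcat (- E) G *\<^sub>v (u @\<^sub>v v) \<le> w \<longleftrightarrow> G *\<^sub>v v \<le> w + E *\<^sub>v u"
      using assms u v by (auto simp: uminus_vec_add_le_iff[of _ q])
    moreover have "hcat (- K) (L_mat m N) *\<^sub>v (u @\<^sub>v v) = - K *\<^sub>v u + vec_first v m"
    proof -
      have "m + m * (N - 1) = m * N"
        using assms(1) by (cases N) auto
      then have "L_mat m N \<in> carrier_mat m (m * N)"
        by (intro carrier_matI) (simp_all add: L_mat_def hcat_def)
      then show ?thesis
        using assms u v L_mat_mult[OF assms(1) v]
        by (subst hcat_mult_append[of _ m n _ "m * N"]) auto
    qed
    then have "hcat (- K) (L_mat m N) *\<^sub>v (u @\<^sub>v v) = b \<longleftrightarrow> vec_first v m = K *\<^sub>v u + b"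
      using assms u v by (auto simp: uminus_vec_add_eq_iff[of _ m])
    ultimately show ?thesis
      using assms u v by (auto simp: P_F_def H_plane_def)
  qed
  show ?thesis
  proof
    assume "x \<in> proj_x n (P_F G w E \<inter> H_plane m N K b)"
    then obtain e where e: "e \<in> P_F G w E \<inter> H_plane m N K b" and x: "x = vec_first e n"
      by (auto simp: proj_x_def)
    then have "e = x @\<^sub>v vec_last e (m * N)"
      using assms by (simp add: P_F_def)
    with e x lift[of x "vec_last e (m * N)"] show "x \<in> carrier_vec n \<and>
        (\<exists>Ub \<in> carrier_vec (m * N). G *\<^sub>v Ub \<le> w + E *\<^sub>v x \<and> vec_first Ub m = K *\<^sub>v x + b)"
      by (metis vec_first_carrier vec_last_carrier)
  next
    assume "x \<in> carrier_vec n \<and>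
        (\<exists>Ub \<in> carrier_vec (m * N). G *\<^sub>v Ub \<le> w + E *\<^sub>v x \<and> vec_first Ub m = K *\<^sub>v x + b)"
    then obtain Ub where x: "x \<in> carrier_vec n" and Ub: "Ub \<in> carrier_vec (m * N)"
      and "x @\<^sub>v Ub \<in> P_F G w E \<inter> H_plane m N K b"
      using lift by blast
    then show "x \<in> proj_x n (P_F G w E \<inter> H_plane m N K b)"
      unfolding proj_x_def using vec_first_append[OF x] by (metis image_eqI)
  qed
qed

section \<open>Recursive feasibility\<close>

lemma input_at_0: "input_at m Ub 0 = vec_first Ub m"
  by (simp add: input_at_def vec_first_def)

lemma state_at_carrier:
  assumes "A \<in> carrier_mat n n" "B \<in> carrier_mat n m" "x \<in> carrier_vec n"
  shows "state_at A B x Ub k \<in> carrier_vec n"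
  using assms by (induction k) (auto intro!: carrier_vecI)

text \<open>The closed-loop trajectory from the successor state is a tail of the trajectory from \<open>x\<close>.\<close>

lemma lqr_set_invariant:
  assumes A: "A \<in> carrier_mat n n" and B: "B \<in> carrier_mat n m" and K: "K \<in> carrier_mat m n"
    and x: "x \<in> lqr_set A B K X U"
  shows "A *\<^sub>v x + B *\<^sub>v (K *\<^sub>v x) \<in> lqr_set A B K X U"
proof -
  let ?L = "A + B * K"
  have L: "?L \<in> carrier_mat n n" and xc: "x \<in> carrier_vec n"
    using A B K x by (auto simp: lqr_set_def)
  have step: "A *\<^sub>v x + B *\<^sub>v (K *\<^sub>v x) = ?L *\<^sub>v x"
    using A B K xc by (simp add: add_mult_distrib_mat_vec[of _ n n])
  have "?L ^\<^sub>m k *\<^sub>v (?L *\<^sub>v x) = ?L ^\<^sub>m Suc k *\<^sub>v x" for k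
    using assoc_mult_mat_vec[OF pow_carrier_mat[OF L, of k] L xc] by simp
  moreover have "?L ^\<^sub>m Suc k *\<^sub>v x \<in> X" "K *\<^sub>v (?L ^\<^sub>m Suc k *\<^sub>v x) \<in> U" for k
    using x unfolding lqr_set_def by blast+
  moreover have "?L *\<^sub>v x \<in> carrier_vec n"
    using L xc by simp
  ultimately show ?thesis
    using A unfolding step lqr_set_def by (simp del: pow_mat.simps)
qed

text \<open>The input sequence is a single stacked vector, so dropping the first input means keeping
  its last \<open>m * (N - 1)\<close> entries.\<close>

definition shift_inputs :: "nat \<Rightarrow> nat \<Rightarrow> real vec \<Rightarrow> real vec \<Rightarrow> real vec" where
  "shift_inputs m N Ub v = vec_last Ub (m * (N - 1)) @\<^sub>v v"

lemma input_at_shift_inputs: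
  assumes Ub: "Ub \<in> carrier_vec (m * N)" and v: "v \<in> carrier_vec m" and k: "k < N"
  shows "input_at m (shift_inputs m N Ub v) k = (if Suc k < N then input_at m Ub (Suc k) else v)"
proof (intro eq_vecI)
  fix i assume "i < dim_vec (if Suc k < N then input_at m Ub (Suc k) else v)"
  then have i: "i < m"
    using v by (auto simp: input_at_def split: if_splits)
  obtain N' where N: "N = Suc N'"
    using k by (cases N) auto
  show "input_at m (shift_inputs m N Ub v) k $ i
      = (if Suc k < N then input_at m Ub (Suc k) else v) $ i"
  proof (cases "Suc k < N")
    case True
    then have "Suc k * m \<le> N' * m"
      using N by (intro mult_le_mono1) simp
    then have "k * m + i < m * N'"
      using i by (simp add: mult.commute)
    then show ?thesis
      using True i v Ub
      by (simp add: N input_at_def shift_inputs_def vec_last_def add_ac)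
  next
    case False
    then have "k = N'"
      using k N by simp
    then show ?thesis
      using i v by (simp add: N input_at_def shift_inputs_def mult.commute)
  qed
qed (use v in \<open>auto simp: input_at_def\<close>)

lemma state_at_successor:
  assumes "\<And>j. j < k \<Longrightarrow> input_at (dim_col B) Ub (Suc j) = input_at (dim_col B) Vb j"
  shows "state_at A B (state_at A B x Ub 1) Vb k = state_at A B x Ub (Suc k)"
  using assms by (induction k) auto

text \<open>The shifted sequence runs through the old states from time 1 to time \<open>N\<close>, and then makes one
  closed-loop step inside the invariant set \<open>T\<close>. The old terminal state is no longer the last one,
  which is why \<open>T\<close> has to be contained in \<open>X\<close>.\<close>

lemma ocp_admissible_shift:
  assumes A: "A \<in> carrier_mat n n" and B: "B \<in> carrier_mat n m" and K: "dim_col K = n"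
    and U: "U \<subseteq> carrier_vec m" and N: "N \<ge> 1"
    and T: "T = lqr_set A B K X U" "T \<subseteq> X"
    and Ub: "Ub \<in> carrier_vec (m * N)" and adm: "ocp_admissible A B X U T N x Ub"
  shows "\<exists>Vb \<in> carrier_vec (m * N). ocp_admissible A B X U T N (state_at A B x Ub 1) Vb"
proof
  define xN where "xN = state_at A B x Ub N"
  define Vb where "Vb = shift_inputs m N Ub (K *\<^sub>v xN)"
  have xN: "xN \<in> lqr_set A B K X U" "xN \<in> X"
    using adm T by (auto simp: ocp_admissible_def xN_def)
  \<comment> \<open>The case of exponent 0 in the definition of the LQR set.\<close>
  then have KxU: "K *\<^sub>v xN \<in> U"
    using A B K by (auto simp: lqr_set_def dest!: spec[of _ 0])
  \<comment> \<open>The number of rows of the gain follows from its value at the terminal state being an input.\<close>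
  with U have Kx: "K *\<^sub>v xN \<in> carrier_vec m"
    by auto
  have Kc: "K \<in> carrier_mat m n"
    using K carrier_vecD[OF Kx] by (intro carrier_matI) simp_all
  have "m * (N - 1) + m = m * N"
    using N by (cases N) auto
  with Kx show Vb: "Vb \<in> carrier_vec (m * N)"
    unfolding Vb_def shift_inputs_def by (metis append_carrier_vec vec_last_carrier)
  have input: "input_at m Vb k = (if Suc k < N then input_at m Ub (Suc k) else K *\<^sub>v xN)"
    if "k < N" for k
    unfolding Vb_def using input_at_shift_inputs[OF Ub Kx that] .
  have dimB: "dim_col B = m"
    using B by simp
  have state: "state_at A B (state_at A B x Ub 1) Vb k = state_at A B x Ub (Suc k)" if "k < N" for k
    using that input dimB by (intro state_at_successor) auto
  obtain N' where N': "N = Suc N'"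
    using N by (cases N) auto
  have "state_at A B (state_at A B x Ub 1) Vb N = A *\<^sub>v xN + B *\<^sub>v (K *\<^sub>v xN)"
    using state[of N'] input[of N'] dimB by (simp add: N' xN_def)
  then have last: "state_at A B (state_at A B x Ub 1) Vb N \<in> T"
    using lqr_set_invariant[OF A B Kc xN(1)] T by simp
  show "ocp_admissible A B X U T N (state_at A B x Ub 1) Vb"
    unfolding ocp_admissible_def dimB
  proof (intro conjI allI impI last)
    fix k assume k: "k < N"
    show "state_at A B (state_at A B x Ub 1) Vb k \<in> X"
    proof (cases "Suc k < N")
      case True
      then show ?thesis
        using adm k state by (auto simp: ocp_admissible_def simp del: state_at.simps)
    next
      case False
      then have "Suc k = N"
        using k by simp
      then show ?thesis
        using state[OF k] xN(2) by (simp add: xN_def del: state_at.simps)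
    qed
    show "input_at m Vb k \<in> U"
      using adm k input KxU dimB by (auto simp: ocp_admissible_def)
  qed
qed

theorem proposition1:
  fixes n m N q :: nat
    and A B Q R P H F Y G E K :: "real mat"
    and w b xhat :: "real vec"
    and X U T C :: "real vec set"
    and Act :: "nat set"
  assumes "N \<ge> 1"
    and "A \<in> carrier_mat n n" and "B \<in> carrier_mat n m"
    and "pos_def n Q" and "pos_def m R"
    and "stabilizable A B" and "detectable (psd_sqrt Q) A"
    and "pos_def n P" and "stabilizing_dare_solution A B Q R P"
    and "polytope_in n X" and "zero_interior n X"
    and "polytope_in m U" and "zero_interior m U"
    and "polytope_in n T" and "zero_interior n T" and "T \<subseteq> X"
    and "T = lqr_set A B (lqr_gain A B R P) X U"
    and "pos_def (m * N) H" and "F \<in> carrier_mat n (m * N)" and "Y \<in> carrier_mat n n"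
    and "G \<in> carrier_mat q (m * N)" and "w \<in> carrier_vec q" and "E \<in> carrier_mat q n"
    and "\<forall>x \<in> carrier_vec n. \<forall>Ub \<in> carrier_vec (m * N).
           qp_cost H F Y x Ub = ocp_cost A B Q R P N x Ub"
    and "\<forall>x \<in> carrier_vec n. \<forall>Ub \<in> carrier_vec (m * N).
           G *\<^sub>v Ub \<le> w + E *\<^sub>v x \<longleftrightarrow> ocp_admissible A B X U T N x Ub"
    and "xhat \<in> feasible_states G w E"
    and "Act = active_set H F Y G w E xhat"
    and "full_row_rank (sub_rows G Act)"
    and "K = K_star m H F G E Act" and "b = b_star m H G w Act"
    and "C = proj_x n (P_F G w E \<inter> H_plane m N K b)"
  shows "(\<forall>x \<in> C. K *\<^sub>v x + b \<in> U) \<and>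
    (\<forall>x \<in> C. A *\<^sub>v x + B *\<^sub>v (K *\<^sub>v x + b) \<in> feasible_states G w E) \<and>
    P_star H F G w E Act \<subseteq> C"
proof -
  note N = assms(1) and A = assms(2) and B = assms(3) and T = assms(17) and TX = assms(16)
    and H = assms(18) and F = assms(19) and G = assms(21) and w = assms(22) and E = assms(23)
    and constraints = assms(25) and Act = assms(27) and rank = assms(28)
    and K = assms(29) and b = assms(30) and C = assms(31)
  have Uc: "U \<subseteq> carrier_vec m"
    using assms(12) by (auto simp: polytope_in_def)
  have "minv H \<in> carrier_mat (m * N) (m * N)"
    using H by (intro minv_of_det_nonzero(1) pos_def_det_nonzero) (auto simp: pos_def_def)
  then have dims: "dim_row (K_bar H F G E Act) = m * N" "dim_col (K_bar H F G E Act) = n"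
    "dim_vec (b_bar H G w Act) = m * N"
    using F by (auto simp: K_bar_def b_bar_def)
  have mN: "m \<le> m * N"
    using N by simp
  then have "{i. i < m * N \<and> i < m} = {0..<m}"
    by (auto intro: less_le_trans simp del: mult_le_cancel1)
  then have Kc: "K \<in> carrier_mat m n"
    unfolding K K_star_def by (intro carrier_matI) (simp_all add: dims)
  have bc: "b \<in> carrier_vec m"
    by (simp add: b b_star_def)
  note mem_C = mem_proj_x_iff[OF N G w E Kc bc, folded C]
  have admissible: "\<exists>Ub \<in> carrier_vec (m * N). ocp_admissible A B X U T N x Ub \<and>
      input_at m Ub 0 = K *\<^sub>v x + b" if "x \<in> C" for x
    using that constraints by (auto simp: mem_C input_at_0)
  show ?thesis
  proof (intro conjI ballI subsetI)
    fix x assume "x \<in> C"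
    with admissible obtain Ub where "ocp_admissible A B X U T N x Ub" "input_at m Ub 0 = K *\<^sub>v x + b"
      by blast
    then show "K *\<^sub>v x + b \<in> U"
      using N B by (auto simp: ocp_admissible_def dest!: spec[of _ 0])
  next
    fix x assume x: "x \<in> C"
    with admissible obtain Ub where Ub: "Ub \<in> carrier_vec (m * N)"
      "ocp_admissible A B X U T N x Ub" "input_at m Ub 0 = K *\<^sub>v x + b"
      by blast
    have succ: "A *\<^sub>v x + B *\<^sub>v (K *\<^sub>v x + b) = state_at A B x Ub 1"
      using B Ub(3) by simp
    have "dim_col (lqr_gain A B R P) = n"
      using A by (simp add: lqr_gain_def)
    then obtain Vb where Vb: "Vb \<in> carrier_vec (m * N)"
      "ocp_admissible A B X U T N (state_at A B x Ub 1) Vb"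
      using ocp_admissible_shift[OF A B _ Uc N T TX Ub(1,2)] by blast
    have "state_at A B x Ub 1 \<in> carrier_vec n"
      using state_at_carrier[OF A B] x by (simp add: mem_C del: state_at.simps)
    then show "A *\<^sub>v x + B *\<^sub>v (K *\<^sub>v x + b) \<in> feasible_states G w E"
      unfolding succ feasible_states_def qp_feasible_def using Vb constraints G E by auto
  next
    fix x assume x: "x \<in> P_star H F G w E Act"
    define Ub where "Ub = K_bar H F G E Act *\<^sub>v x + b_bar H G w Act"
    have "Act \<subseteq> {0..<q}"
      using G by (auto simp: Act active_set_def)
    then have "G *\<^sub>v Ub \<le> w + E *\<^sub>v x"
      unfolding Ub_def by (rule affine_law_feasible_on_P_star[OF H F G w E _ rank x])
    moreover have "vec_first Ub m = K *\<^sub>v x + b"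
      unfolding Ub_def K b by (rule first_input_of_affine_law) (simp_all only: dims mN)
    moreover have "Ub \<in> carrier_vec (m * N)"
      unfolding Ub_def by (rule carrier_vecI) (simp add: dims)
    moreover have "x \<in> carrier_vec n"
      using x E by (simp add: P_star_def)
    ultimately show "x \<in> C"
      by (auto simp: mem_C)
  qed
qed

end
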